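(* For every interval $[a,b]\subset[0,1]$, as $X\to\infty$, $$\#\{(T_{p,q},\alpha)\in\Omega_1(X)\mid \theta(\alpha)\in[a,b]\}=\frac{(b-a)}{4\zeta(2)}X^4+O(X^3\log X).$$
   Context: For coprime positive integers $p,q$, $T_{p,q}$ denotes the $(p,q)$-torus knot, with Alexander polynomial $\Delta_{p,q}(t)=\frac{(t^{pq}-1)(t-1)}{(t^p-1)(t^q-1)}$, and height $\max\{p,q\}$. The pair $(p,q)$ is identified with $T_{p,q}$ (so pairs are ordered). For $X>0$, $\Omega_1(X)$ is the set of all pairs $(T_{p,q},\alpha)$ where $p,q$ are coprime positive integers with $\max\{p,q\}\le X$ and $\alpha\in\mathbb{C}$ is a root of $\Delta_{p,q}(t)$. Let $\mathbb{T}=\{z\in\mathbb{C}: |z|=1\}$ and write each $z\in\mathbb{T}$ as $z=e^{2\pi i\theta(z)}$ with $\theta(z)\in[0,1)$; all roots of $\Delta_{p,q}(t)$ lie on $\mathbb{T}$. Here $\zeta(2)=\sum_{n\ge1}n^{-2}=\pi^2/6$, and $f(X)=g(X)+O(h(X))$ has its usual meaning: $|f(X)-g(X)|\le C\,h(X)$ for some constant $C$ and all sufficiently large $X$. *)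

theory Defs
  imports
    "HOL-Analysis.Analysis"
    "HOL-Computational_Algebra.Computational_Algebra"
    "HOL-Library.Landau_Symbols"
begin

text \<open>
  The torus knot \<open>T\<^sub>p\<^sub>,\<^sub>q\<close> is identified with the ordered pair \<open>(p, q)\<close> of its parameters.
\<close>

type_synonym torus_knot = "nat \<times> nat"

definition torus_knots :: "torus_knot set" where
  "torus_knots = {(p, q). 0 < p \<and> 0 < q \<and> coprime p q}"

definition height :: "torus_knot \<Rightarrow> nat" where
  "height K = (case K of (p, q) \<Rightarrow> max p q)"

text \<open>
  The division of polynomials below is exact for torus knots, see
  \<open>alexander_poly_mult_denominator\<close>.
\<close>

definition alexander_poly :: "torus_knot \<Rightarrow> complex poly" where
  "alexander_poly K = (case K of (p, q) \<Rightarrow>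
     ((monom 1 (p * q) - 1) * (monom 1 1 - 1)) div ((monom 1 p - 1) * (monom 1 q - 1)))"

definition Omega1 :: "real \<Rightarrow> (torus_knot \<times> complex) set" where
  "Omega1 X = {(K, \<alpha>). K \<in> torus_knots \<and> real (height K) \<le> X \<and> poly (alexander_poly K) \<alpha> = 0}"

text \<open>
  Since \<open>Arg2pi\<close> takes values in \<open>[0, 2\<pi>)\<close>, this is the unique \<open>\<theta>(z) \<in> [0, 1)\<close> with
  \<open>z = exp (2\<pi>\<i>\<theta>(z))\<close> when \<open>z\<close> is on the unit circle.
\<close>

definition theta :: "complex \<Rightarrow> real" where
  "theta z = Arg2pi z / (2 * pi)"

definition zeta2 :: real where
  "zeta2 = (\<Sum>n. 1 / real (Suc n) ^ 2)"

lemma zeta2_eq: "zeta2 = pi\<^sup>2 / 6"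
  using inverse_squares_sums by (simp add: zeta2_def sums_iff add.commute)

lemma theta_range: "0 \<le> theta z" "theta z < 1"
  using Arg2pi_ge_0[of z] Arg2pi_lt_2pi[of z] by (simp_all add: theta_def)

lemma theta_eq:
  assumes "norm z = 1"
  shows "z = exp (2 * complex_of_real pi * \<i> * complex_of_real (theta z))"
  using complex_norm_eq_1_exp[of z] assms by (simp add: theta_def mult_ac)

lemma monom_power_eq: "(monom 1 n :: complex poly) = monom 1 1 ^ n"
  by (simp add: monom_power)

lemma alexander_poly_mult_denominator:
  assumes "(p, q) \<in> torus_knots"
  shows "alexander_poly (p, q) * ((monom 1 p - 1) * (monom 1 q - 1)) =
         (monom 1 (p * q) - 1) * (monom 1 1 - 1)"
proof -
  have pos: "0 < p" "0 < q" and cop: "coprime p q"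
    using assms by (auto simp: torus_knots_def)
  define x :: "complex poly" where "x = monom 1 1"
  define G where "G n = (\<Sum>i<n. x ^ i)" for n
  have G: "x ^ n - 1 = (x - 1) * G n" for n
    by (simp add: power_diff_1_eq G_def)
  have x1: "x - 1 \<noteq> 0"
    by (simp add: x_def monom_eq_1_iff)
  have mult: "\<exists>R. G (m * k) = G m * R" for m k
  proof -
    have "(x - 1) * G (m * k) = (x - 1) * (G m * (\<Sum>i<k. (x ^ m) ^ i))"
      using power_diff_1_eq[of "x ^ m" k] by (simp add: power_mult mult.assoc flip: G)
    with x1 show ?thesis by auto
  qed
  obtain a b where ab: "p * a = q * b + 1"
    using bezout_nat[of p q] cop pos by auto
  obtain R S where R: "G (p * a) = G p * R" and S: "G (q * b) = G q * S"
    using mult by blast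
  have "(x - 1) * (G p * R - x * (G q * S)) = (x ^ (p * a) - 1) - x * (x ^ (q * b) - 1)"
    unfolding G R S by (simp add: algebra_simps)
  also have "\<dots> = (x - 1) * 1"
    unfolding ab by (simp add: right_diff_distrib)
  finally have bezout: "G p * R - x * (G q * S) = 1"
    using x1 by simp
  obtain U V where U: "G (p * q) = G p * U" and V: "G (p * q) = G q * V"
    using mult[of p q] mult[of q p] by (auto simp: mult.commute)
  have "G (p * q) = G (p * q) * (G p * R) - G (p * q) * (x * (G q * S))"
    using bezout by (simp flip: right_diff_distrib)
  also have "\<dots> = (G q * V) * (G p * R) - (G p * U) * (x * (G q * S))"
    by (simp flip: U V)
  also have "\<dots> = G p * G q * (V * R - U * x * S)"
    by (simp add: algebra_simps)
  finally have "G p * G q dvd G (p * q)"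
    by (rule dvdI)
  then have "(x ^ p - 1) * (x ^ q - 1) dvd (x ^ (p * q) - 1) * (x - 1)"
    using x1 by (simp add: G mult_ac)
  then show ?thesis
    unfolding alexander_poly_def prod.case monom_power_eq[of p] monom_power_eq[of q]
      monom_power_eq[of "p * q"] x_def
    by (rule dvd_div_mult_self)
qed

lemma alexander_poly_nonzero:
  assumes "K \<in> torus_knots"
  shows "alexander_poly K \<noteq> 0"
proof -
  obtain p q where K: "K = (p, q)" by (cases K)
  have "(monom 1 (p * q) - 1) * (monom 1 1 - 1) \<noteq> (0 :: complex poly)"
    using assms by (simp add: K torus_knots_def monom_eq_1_iff)
  then show ?thesis
    using alexander_poly_mult_denominator[of p q] assms K by auto
qed

lemma finite_Omega1: "finite (Omega1 X)"
proof (rule finite_subset)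
  let ?S = "{K \<in> torus_knots. real (height K) \<le> X}"
  show "Omega1 X \<subseteq> (SIGMA K:?S. {\<alpha>. poly (alexander_poly K) \<alpha> = 0})"
    by (auto simp: Omega1_def)
  have "?S \<subseteq> {..nat \<lfloor>X\<rfloor>} \<times> {..nat \<lfloor>X\<rfloor>}"
    by (auto simp: height_def torus_knots_def max_def le_nat_floor split: if_splits)
  then have "finite ?S"
    by (rule finite_subset) simp
  then show "finite (SIGMA K:?S. {\<alpha>. poly (alexander_poly K) \<alpha> = 0})"
    by (rule finite_SigmaI) (simp_all add: poly_roots_finite alexander_poly_nonzero)
qed

lemma alexander_poly_root_norm:
  assumes "(p, q) \<in> torus_knots" and "poly (alexander_poly (p, q)) \<alpha> = 0"
  shows "norm \<alpha> = 1"
proof -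
  have "poly ((monom 1 (p * q) - 1) * (monom 1 1 - 1)) \<alpha> = 0"
    unfolding alexander_poly_mult_denominator[OF assms(1), symmetric] using assms(2) by simp
  then have "\<alpha> ^ (p * q) = 1 \<or> \<alpha> = 1"
    by (simp add: poly_monom)
  moreover have "0 < p * q"
    using assms(1) by (simp add: torus_knots_def)
  ultimately show ?thesis
    by (metis norm_one power_eq_1_iff neq0_conv)
qed

end

theory Submission
  imports Defs
begin

text \<open>
  Moebius inversion reduces the sum of \<open>p q\<close> over coprime \<open>p, q \<le> N\<close> to
  \<open>\<Sum>d\<le>N. \<mu>(d) d\<^sup>2 T(N div d)\<^sup>2\<close> with \<open>T(m) = m (m + 1) / 2\<close>, that is
  \<open>N\<^sup>4/4 \<cdot> (\<Sum>d\<le>N. \<mu>(d) / d\<^sup>2)\<close> up to \<open>O(N\<^sup>3 log N)\<close>. The finite identity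
  \<open>\<Sum>d\<le>N. \<mu>(d) / d\<^sup>2 \<cdot> (\<Sum>k\<le>N div d. 1 / k\<^sup>2) = 1\<close> and the tail bound for \<open>\<zeta>(2)\<close> replace the
  Dirichlet series of \<open>\<mu>\<close> at 2. For a fixed knot, the roots of the Alexander polynomial are
  \<open>pq\<close>-th roots of unity, all of them except at most \<open>p + q\<close>, so \<open>(b - a) p q + O(p + q)\<close>
  of them have argument in \<open>[a, b]\<close>.
\<close>

section \<open>The Moebius function and its divisor sums\<close>

definition moebius :: "nat \<Rightarrow> int" where
  "moebius n = (if squarefree n then (- 1) ^ card (prime_factors n) else 0)"

lemma abs_moebius_le_1: "\<bar>moebius n\<bar> \<le> 1"
  by (simp add: moebius_def power_abs)

lemma moebius_1 [simp]: "moebius 1 = 1" "moebius (Suc 0) = 1"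
  by (simp_all add: moebius_def)

text \<open>Coprimality makes \<open>p * n\<close> squarefree exactly when \<open>n\<close> is, and
  the set of prime factors gains the single element \<open>p\<close>, which flips the sign.\<close>

lemma moebius_prime_mult:
  assumes "prime p" and "\<not> p dvd n"
  shows "moebius (p * n) = - moebius n"
proof -
  have cop: "coprime p n"
    using assms by (simp add: prime_imp_coprime)
  have "n \<noteq> 0" "p \<noteq> 0"
    using assms by (auto intro!: Nat.gr0I)
  then have "prime_factors (p * n) = insert p (prime_factors n)"
    using assms by (simp add: prime_factors_product prime_prime_factors)
  moreover have "p \<notin> prime_factors n"
    using assms by (auto simp: in_prime_factors_iff)
  moreover have "squarefree (p * n) \<longleftrightarrow> squarefree n"
    using cop assms squarefree_mult_coprime[of p n] squarefree_prime[of p] squarefree_multD[of p n]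
    by blast
  ultimately show ?thesis
    by (simp add: moebius_def)
qed

lemma sum_moebius_divisors:
  assumes "n > 0"
  shows "(\<Sum>d | d dvd n. moebius d) = (if n = 1 then 1 else 0)"
proof (cases "n = 1")
  case False
  \<comment> \<open>For a prime \<open>p\<close> dividing \<open>n\<close>, the terms of \<open>d\<close> and \<open>p d\<close> cancel.\<close>
  then obtain p where p: "prime p" "p dvd n"
    using prime_factor_nat by blast
  define A where "A = {d. d dvd n \<and> squarefree d \<and> \<not> p dvd d}"
  have fin: "finite {d. d dvd n}" using assms by simp
  then have finA: "finite A" by (rule rev_finite_subset) (auto simp: A_def)
  have inj: "inj_on ((*) p) A"
    using p by (auto simp: inj_on_def)
  have D: "{d. d dvd n \<and> squarefree d} = A \<union> (*) p ` A"
  proof (intro equalityI subsetI)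
    fix d assume d: "d \<in> {d. d dvd n \<and> squarefree d}"
    show "d \<in> A \<union> (*) p ` A"
    proof (cases "p dvd d")
      case True
      then obtain e where e: "d = p * e" by blast
      have "\<not> p dvd e"
        using d p squarefreeD[of d p] unfolding e by (auto simp: power2_eq_square)
      moreover have "e dvd n" "squarefree e"
        using d unfolding e by (auto dest: dvd_mult_right squarefree_multD)
      ultimately show ?thesis by (auto simp: A_def e)
    qed (use d in \<open>auto simp: A_def\<close>)
  next
    fix d assume "d \<in> A \<union> (*) p ` A"
    then show "d \<in> {d. d dvd n \<and> squarefree d}"
    proof
      assume "d \<in> (*) p ` A"
      then obtain e where e: "d = p * e" "e \<in> A" by blast
      then have "coprime p e" using p by (simp add: A_def prime_imp_coprime)
      then show ?thesis
        using e p by (auto simp: A_def intro: divides_mult squarefree_mult_coprime squarefree_prime)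
    qed (auto simp: A_def)
  qed
  have "(\<Sum>d | d dvd n. moebius d) = (\<Sum>d | d dvd n \<and> squarefree d. moebius d)"
    using fin by (intro sum.mono_neutral_right) (auto simp: moebius_def)
  also have "\<dots> = (\<Sum>d\<in>A. moebius d) + (\<Sum>d\<in>(*) p ` A. moebius d)"
    unfolding D using finA by (intro sum.union_disjoint) (auto simp: A_def)
  also have "(\<Sum>d\<in>(*) p ` A. moebius d) = (\<Sum>d\<in>A. - moebius d)"
    unfolding sum.reindex[OF inj] o_def using p
    by (intro sum.cong refl moebius_prime_mult) (auto simp: A_def)
  finally show ?thesis
    using False by (simp add: sum_negf)
qed simp

section \<open>The sum of \<open>p * q\<close> over coprime pairs\<close>

lemma sum_multiples:
  fixes f :: "nat \<Rightarrow> 'a :: comm_monoid_add"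
  assumes "d > 0"
  shows "(\<Sum>n\<in>{n \<in> {1..N}. d dvd n}. f n) = (\<Sum>k=1..N div d. f (d * k))"
proof (rule sum.reindex_bij_witness[where i = "\<lambda>k. d * k" and j = "\<lambda>n. n div d"])
  fix k assume "k \<in> {1..N div d}"
  then show "d * k \<in> {n \<in> {1..N}. d dvd n}"
    using assms by (auto simp: less_eq_div_iff_mult_less_eq mult.commute)
qed (use assms in \<open>auto simp: div_le_mono dvd_div_eq_0_iff Suc_le_eq div_greater_zero_iff dvd_imp_le\<close>)

definition coprime_pairs :: "nat \<Rightarrow> (nat \<times> nat) set" where
  "coprime_pairs N = {(p, q). p \<in> {1..N} \<and> q \<in> {1..N} \<and> coprime p q}"

lemma finite_coprime_pairs [simp]: "finite (coprime_pairs N)"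
  by (rule finite_subset[of _ "{1..N} \<times> {1..N}"]) (auto simp: coprime_pairs_def)

lemma card_coprime_pairs_le: "card (coprime_pairs N) \<le> N ^ 2"
proof -
  have "card (coprime_pairs N) \<le> card ({1..N} \<times> {1..N})"
    by (rule card_mono) (auto simp: coprime_pairs_def)
  then show ?thesis by (simp add: power2_eq_square)
qed

text \<open>The coprimality indicator is the sum of mu(d) over common divisors d. Once d is the
  outermost variable, p and q run independently over the multiples of d, so the inner double sum is
  a square.\<close>

lemma sum_coprime_pairs:
  "(\<Sum>(p, q)\<in>coprime_pairs N. real (p * q)) =
   (\<Sum>d=1..N. moebius d * (d * (\<Sum>k=1..N div d. real k)) ^ 2)"
proof -
  \<comment> \<open>Every divisor of \<open>gcd p q\<close> is at most \<open>N\<close>, so d can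
    range over a set independent of p and q. This is what permits the exchange of sums
    below.\<close>
  have ind: "of_bool (coprime p q) =
      (\<Sum>d=1..N. of_int (moebius d) * of_bool (d dvd p) * of_bool (d dvd q) :: real)"
    if "p \<in> {1..N}" "q \<in> {1..N}" for p q
  proof -
    have "gcd p q > 0" using that by auto
    from sum_moebius_divisors[OF this]
    have "of_bool (coprime p q) = real_of_int (\<Sum>d | d dvd gcd p q. moebius d)"
      by (simp add: coprime_iff_gcd_eq_1)
    also have "\<dots> = (\<Sum>d | d \<in> {1..N} \<and> d dvd p \<and> d dvd q. real_of_int (moebius d))"
      using that unfolding of_int_sum
      by (intro sum.cong) (auto dest: dvd_imp_le intro!: Suc_leI Nat.gr0I)
    also have "\<dots> = (\<Sum>d=1..N. if d dvd p \<and> d dvd q then real_of_int (moebius d) else 0)"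
      by (subst sum.inter_filter[symmetric]) (auto)
    also have "\<dots> = (\<Sum>d=1..N. of_int (moebius d) * of_bool (d dvd p) * of_bool (d dvd q))"
      by (intro sum.cong) auto
    finally show ?thesis .
  qed
  have "(\<Sum>(p, q)\<in>coprime_pairs N. real (p * q)) =
      (\<Sum>(p, q)\<in>{1..N} \<times> {1..N}. of_bool (coprime p q) * (real p * real q))"
    by (rule sum.mono_neutral_cong_left) (auto simp: coprime_pairs_def)
  also have "\<dots> = (\<Sum>p=1..N. \<Sum>q=1..N. of_bool (coprime p q) * (real p * real q))"
    by (rule sum.cartesian_product[symmetric])
  also have "\<dots> = (\<Sum>p=1..N. \<Sum>q=1..N. \<Sum>d=1..N.
      of_int (moebius d) * ((of_bool (d dvd p) * real p) * (of_bool (d dvd q) * real q)))"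
    by (intro sum.cong refl, subst ind) (auto simp: sum_distrib_left mult_ac)
  also have "\<dots> = (\<Sum>p=1..N. \<Sum>d=1..N. \<Sum>q=1..N.
      of_int (moebius d) * ((of_bool (d dvd p) * real p) * (of_bool (d dvd q) * real q)))"
    by (intro sum.cong refl sum.swap)
  also have "\<dots> = (\<Sum>d=1..N. \<Sum>p=1..N. \<Sum>q=1..N.
      of_int (moebius d) * ((of_bool (d dvd p) * real p) * (of_bool (d dvd q) * real q)))"
    by (rule sum.swap)
  also have "\<dots> = (\<Sum>d=1..N. moebius d * (\<Sum>p=1..N. of_bool (d dvd p) * real p) ^ 2)"
    unfolding power2_eq_square sum_product by (simp only: sum_distrib_left)
  also have "\<dots> = (\<Sum>d=1..N. moebius d * (d * (\<Sum>k=1..N div d. real k)) ^ 2)"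
  proof (intro sum.cong refl)
    fix d assume d: "d \<in> {1..N}"
    have "(\<Sum>p=1..N. of_bool (d dvd p) * real p) = (\<Sum>p | p \<in> {1..N} \<and> d dvd p. real p)"
      by (rule sum.mono_neutral_cong_right) auto
    also have "\<dots> = d * (\<Sum>k=1..N div d. real k)"
      using d sum_multiples[of d real N] by (simp add: sum_distrib_left)
    finally show "moebius d * (\<Sum>p=1..N. of_bool (d dvd p) * real p) ^ 2 =
        moebius d * (d * (\<Sum>k=1..N div d. real k)) ^ 2" by simp
  qed
  finally show ?thesis .
qed

lemma div_bounds:
  assumes "d > 0"
  shows "real d * real (N div d) \<le> real N" "real N \<le> real d * (real (N div d) + 1)"
proof -
  have "d * (N div d) \<le> N" by simp
  then show "real d * real (N div d) \<le> real N"
    by (metis of_nat_le_iff of_nat_mult)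
  have "N \<le> d * (N div d + 1)"
    using dividend_less_times_div[of d N] assms by simp
  then show "real N \<le> real d * (real (N div d) + 1)"
    by (metis of_nat_le_iff of_nat_mult of_nat_add of_nat_1)
qed

text \<open>With \<open>m = N div d\<close>, the square equals y^2 / (4 d^2) for y = (d m) (d (m +
  1)). The two factors of y enclose \<open>N\<close> and each is within d of it, hence |y - N^2|
  \<le> N d.\<close>

lemma sum_multiples_square_bound:
  assumes d: "d \<in> {1..N}"
  shows "\<bar>(d * (\<Sum>k=1..N div d. real k)) ^ 2 - real N ^ 4 / 4 / real d ^ 2\<bar> \<le> 3/4 * real N ^ 3 / d"
proof -
  define m where "m = N div d"
  define y where "y = (real d * real m) * (real d * (real m + 1))"
  have d0: "real d > 0" using d by simp
  then have "d > 0" by simp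
  note b = div_bounds[OF this, of N, folded m_def]
  have dN: "real d \<le> N" using d by simp
  have T: "(\<Sum>k=1..m. real k) = real m * (real m + 1) / 2"
    by (induction m) (auto simp: field_simps)
  have "y \<le> real N * (real N + real d)"
    unfolding y_def using b d by (intro mult_mono) (auto simp: algebra_simps)
  then have y_up: "y - real N ^ 2 \<le> real N * d"
    by (simp add: power2_eq_square algebra_simps)
  have "(real N - d) * N \<le> y"
    unfolding y_def using b d by (intro mult_mono) (auto simp: algebra_simps)
  then have y_lo: "real N ^ 2 - y \<le> real N * d"
    by (simp add: power2_eq_square algebra_simps)
  have "real N * d \<le> real N * N" using dN by (intro mult_left_mono) auto
  with y_up have y2: "y + real N ^ 2 \<le> 3 * real N ^ 2" by (simp add: power2_eq_square)
  have y0: "y \<ge> 0" by (simp add: y_def)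
  \<comment> \<open>Difference of squares; the factor 3 arises because d \<le> N gives y \<le> 2
    N^2.\<close>
  have "\<bar>y ^ 2 - real N ^ 4\<bar> = \<bar>y - real N ^ 2\<bar> * \<bar>y + real N ^ 2\<bar>"
    unfolding abs_mult[symmetric] by (simp add: algebra_simps power2_eq_square power4_eq_xxxx)
  also have "\<dots> \<le> (real N * d) * (3 * real N ^ 2)"
    using y_up y_lo y2 y0 by (intro mult_mono) auto
  finally have main: "\<bar>y ^ 2 - real N ^ 4\<bar> \<le> 3 * real N ^ 3 * d"
    by (simp add: power2_eq_square power3_eq_cube mult_ac)
  have "(d * (\<Sum>k=1..m. real k)) ^ 2 - real N ^ 4 / 4 / real d ^ 2 = (y ^ 2 - real N ^ 4) / (4 * real d ^ 2)"
    unfolding T y_def using d0 by (simp add: field_simps power2_eq_square)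
  also have "\<bar>\<dots>\<bar> = \<bar>y ^ 2 - real N ^ 4\<bar> / (4 * real d ^ 2)"
    by simp
  also have "\<dots> \<le> 3 * real N ^ 3 * d / (4 * real d ^ 2)"
    using main by (intro divide_right_mono) auto
  also have "\<dots> = 3/4 * real N ^ 3 / d"
    using d0 by (simp add: field_simps power2_eq_square)
  finally show ?thesis unfolding m_def .
qed

text \<open>Since |mu(d)| \<le> 1, the errors for the single d simply add up. Their 1/d decay
  produces the harmonic number, the source of the logarithm.\<close>

lemma sum_coprime_pairs_bound:
  "\<bar>(\<Sum>(p, q)\<in>coprime_pairs N. real (p * q)) - real N ^ 4 / 4 * (\<Sum>d=1..N. moebius d / real d ^ 2)\<bar>
   \<le> 3/4 * real N ^ 3 * harm N"
proof -
  have "(\<Sum>(p, q)\<in>coprime_pairs N. real (p * q)) - real N ^ 4 / 4 * (\<Sum>d=1..N. moebius d / real d ^ 2) =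
    (\<Sum>d=1..N. moebius d * ((d * (\<Sum>k=1..N div d. real k)) ^ 2 - real N ^ 4 / 4 / real d ^ 2))"
    unfolding sum_coprime_pairs sum_distrib_left sum_subtractf[symmetric]
    by (intro sum.cong) (auto simp: algebra_simps)
  also have "\<bar>\<dots>\<bar> \<le> (\<Sum>d=1..N. 3/4 * real N ^ 3 / d)"
  proof (rule order.trans[OF sum_abs], intro sum_mono)
    fix d assume d: "d \<in> {1..N}"
    have "\<bar>real_of_int (moebius d)\<bar> \<le> 1"
      using abs_moebius_le_1[of d] by linarith
    then show "\<bar>moebius d * ((d * (\<Sum>k=1..N div d. real k)) ^ 2 - real N ^ 4 / 4 / real d ^ 2)\<bar>
        \<le> 3/4 * real N ^ 3 / d"
      unfolding abs_mult
      using mult_mono[OF _ sum_multiples_square_bound[OF d], of "\<bar>real_of_int (moebius d)\<bar>" 1] by simp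
  qed
  also have "\<dots> = 3/4 * real N ^ 3 * harm N"
    by (simp add: harm_def sum_distrib_left field_simps)
  finally show ?thesis .
qed

section \<open>Partial sums of mu(d) / d^2\<close>

lemma zeta2_ge_1: "zeta2 \<ge> 1"
proof -
  have "pi ^ 2 \<ge> 3 ^ 2" using pi_gt3 by (intro power_mono) auto
  then show ?thesis by (simp add: zeta2_eq)
qed

text \<open>The partial sums increase to \<open>zeta2\<close>. Adding 1/m makes them decrease to the
  same limit, because 1/(m+1)^2 \<le> 1/m - 1/(m+1).\<close>

lemma zeta2_tail_bound:
  assumes "m > 0"
  shows "\<bar>(\<Sum>k=1..m. 1 / real k ^ 2) - zeta2\<bar> \<le> 1 / m"
proof -
  define s where "s m = (\<Sum>k=1..m. 1 / real k ^ 2)" for m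
  have "(\<lambda>n. 1 / real (Suc n) ^ 2) sums zeta2"
    using inverse_squares_sums by (simp add: zeta2_eq add.commute)
  moreover have "(\<Sum>k<n. 1 / real (Suc k) ^ 2) = s n" for n
    unfolding s_def by (induction n) auto
  ultimately have lim: "s \<longlonglongrightarrow> zeta2"
    by (simp add: sums_def)
  have "incseq s"
    by (rule incseq_SucI) (simp add: s_def)
  then have lo: "s m \<le> zeta2"
    using incseq_le lim by blast
  \<comment> \<open>The shift by \<open>Suc\<close> excludes index 0, where 1/0 = 0 would break
    monotonicity.\<close>
  have "decseq (\<lambda>n. s (Suc n) + 1 / real (Suc n))"
  proof (rule decseq_SucI)
    fix n
    have "1 / real (Suc (Suc n)) ^ 2 + 1 / real (Suc (Suc n)) \<le> 1 / real (Suc n)"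
      by (simp add: divide_simps power2_eq_square) (simp add: algebra_simps)
    then show "s (Suc (Suc n)) + 1 / real (Suc (Suc n)) \<le> s (Suc n) + 1 / real (Suc n)"
      by (simp add: s_def)
  qed
  moreover have "(\<lambda>n. s (Suc n) + 1 / real (Suc n)) \<longlonglongrightarrow> zeta2 + 0"
    using lim by (intro tendsto_add LIMSEQ_Suc[of s] LIMSEQ_Suc[OF lim_1_over_n])
  ultimately have "zeta2 \<le> s (Suc (m - 1)) + 1 / real (Suc (m - 1))"
    using decseq_ge by fastforce
  with lo assms show ?thesis
    unfolding s_def[symmetric] by auto
qed

text \<open>Grouping the terms by n = d k gives 1/n^2 the coefficient \<Sum> mu(d) over d dividing
  n, which vanishes unless n = 1. The cutoff d k \<le> N keeps all divisors of each n, so the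
  truncated identity is exact.\<close>

lemma sum_moebius_over_squares:
  "N > 0 \<Longrightarrow> (\<Sum>d=1..N. moebius d / real d ^ 2 * (\<Sum>k=1..N div d. 1 / real k ^ 2)) = 1"
proof -
  assume N: "N > 0"
  have "(\<Sum>d=1..N. moebius d / real d ^ 2 * (\<Sum>k=1..N div d. 1 / real k ^ 2)) =
      (\<Sum>d=1..N. \<Sum>n | n \<in> {1..N} \<and> d dvd n. moebius d / real n ^ 2)"
  proof (intro sum.cong refl)
    fix d assume "d \<in> {1..N}"
    then show "moebius d / real d ^ 2 * (\<Sum>k=1..N div d. 1 / real k ^ 2) =
        (\<Sum>n | n \<in> {1..N} \<and> d dvd n. moebius d / real n ^ 2)"
      using sum_multiples[of d "\<lambda>n. moebius d / real n ^ 2" N]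
      by (simp add: sum_distrib_left power_mult_distrib)
  qed
  also have "\<dots> = (\<Sum>n=1..N. \<Sum>d | d \<in> {1..N} \<and> d dvd n. moebius d / real n ^ 2)"
    by (rule sum.swap_restrict) auto
  also have "\<dots> = (\<Sum>n=1..N. if n = 1 then 1 else 0)"
  proof (intro sum.cong refl)
    fix n assume n: "n \<in> {1..N}"
    then have "{d. d \<in> {1..N} \<and> d dvd n} = {d. d dvd n}"
      by (auto dest: dvd_imp_le intro!: Suc_leI Nat.gr0I)
    then have "(\<Sum>d | d \<in> {1..N} \<and> d dvd n. moebius d / real n ^ 2) =
        real_of_int (\<Sum>d | d dvd n. moebius d) / real n ^ 2"
      by (simp add: sum_divide_distrib)
    then show "(\<Sum>d | d \<in> {1..N} \<and> d dvd n. moebius d / real n ^ 2) = (if n = 1 then 1 else 0)"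
      using n by (subst (asm) sum_moebius_divisors) auto
  qed
  also have "\<dots> = 1"
    using N by simp
  finally show ?thesis .
qed

text \<open>Replacing each inner sum of the finite identity by \<open>zeta2\<close> costs |mu(d)| /
  d^2 times a tail of size at most 2 d / N; summing over d gives the harmonic number. The final
  division by \<open>zeta2\<close> is harmless as \<open>zeta2\<close> is at least 1.\<close>

lemma sum_moebius_bound:
  assumes N: "N > 0"
  shows "\<bar>(\<Sum>d=1..N. moebius d / real d ^ 2) - 1 / zeta2\<bar> \<le> 2 * harm N / N"
proof -
  define M where "M = (\<Sum>d=1..N. moebius d / real d ^ 2)"
  have "1 - M * zeta2 =
      (\<Sum>d=1..N. moebius d / real d ^ 2 * ((\<Sum>k=1..N div d. 1 / real k ^ 2) - zeta2))"
    unfolding right_diff_distrib sum_subtractf sum_moebius_over_squares[OF N]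
    by (simp add: M_def sum_distrib_right)
  also have "\<bar>\<dots>\<bar> \<le> (\<Sum>d=1..N. 2 / N * (1 / d))"
  proof (rule order.trans[OF sum_abs], intro sum_mono)
    fix d assume d: "d \<in> {1..N}"
    then have m: "N div d > 0" by (simp add: div_greater_zero_iff)
    \<comment> \<open>The quotient is at least 1, so rounding down loses at most a factor of
      2.\<close>
    then have "real d * (real (N div d) + 1) \<le> real d * (2 * real (N div d))"
      by (intro mult_left_mono) auto
    moreover have "real N \<le> real d * (real (N div d) + 1)"
      using div_bounds(2)[of d N] d by simp
    ultimately have "real N \<le> 2 * real d * real (N div d)" by linarith
    with m N have *: "1 / real (N div d) \<le> 2 * real d / N"
      by (simp add: field_simps)
    have "\<bar>moebius d / real d ^ 2\<bar> \<le> 1 / real d ^ 2"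
      using abs_moebius_le_1[of d] by (simp add: abs_div divide_right_mono flip: of_int_abs)
    then have "\<bar>moebius d / real d ^ 2 * ((\<Sum>k=1..N div d. 1 / real k ^ 2) - zeta2)\<bar>
        \<le> 1 / real d ^ 2 * (2 * real d / N)"
      unfolding abs_mult using * zeta2_tail_bound[OF m] by (intro mult_mono) auto
    also have "\<dots> = 2 / N * (1 / d)"
      using d by (simp add: field_simps power2_eq_square)
    finally show "\<bar>moebius d / real d ^ 2 * ((\<Sum>k=1..N div d. 1 / real k ^ 2) - zeta2)\<bar>
        \<le> 2 / N * (1 / d)" .
  qed
  also have "\<dots> = 2 * harm N / N"
    by (simp add: harm_def sum_distrib_left sum_divide_distrib field_simps)
  finally have *: "\<bar>1 - M * zeta2\<bar> \<le> 2 * harm N / N" .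
  have "M - 1 / zeta2 = (M * zeta2 - 1) / zeta2"
    using zeta2_ge_1 by (simp add: field_simps)
  then have "\<bar>M - 1 / zeta2\<bar> = \<bar>1 - M * zeta2\<bar> / zeta2"
    using zeta2_ge_1 by (simp add: abs_minus_commute)
  also have "\<dots> \<le> \<bar>1 - M * zeta2\<bar> / 1"
    using zeta2_ge_1 by (intro divide_left_mono) auto
  finally show ?thesis
    using * by (simp add: M_def)
qed

section \<open>Roots of one Alexander polynomial in an arc\<close>

text \<open>The \<open>k\<close> in question are integers between a n and b n. Rounding the two
  endpoints accounts for the error 2.\<close>

lemma card_fractions_bound:
  fixes a b :: real
  assumes "0 \<le> a" "a \<le> b" "b \<le> 1" "n > 0"
  shows "\<bar>real (card {k. k < n \<and> real k / n \<in> {a..b}}) - (b - a) * n\<bar> \<le> 2"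
proof -
  have 1: "{k. k < n \<and> real k / n \<in> {a..b}} \<subseteq> {nat \<lceil>a * n\<rceil>..<Suc (nat \<lfloor>b * n\<rfloor>)}"
    using assms by (auto simp: field_simps le_nat_floor less_Suc_eq_le nat_le_iff ceiling_le_iff)
  \<comment> \<open>The right end is left out because for b = 1 it would be the forbidden
    \<open>k = n\<close>.\<close>
  have 2: "{nat \<lceil>a * n\<rceil>..<nat \<lfloor>b * n\<rfloor>} \<subseteq> {k. k < n \<and> real k / n \<in> {a..b}}"
  proof safe
    fix k assume k: "k \<in> {nat \<lceil>a * n\<rceil>..<nat \<lfloor>b * n\<rfloor>}"
    have "b * n \<le> 1 * real n" using assms by (intro mult_right_mono) auto
    moreover have "real k < b * n" "a * n \<le> k"
      using k by (auto simp: nat_le_iff ceiling_le_iff zless_nat_eq_int_zless less_floor_iff)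
    ultimately have "real k < real n" by linarith
    then show "k < n" by simp
    show "real k / n \<in> {a..b}"
      using assms \<open>real k < b * n\<close> \<open>a * n \<le> k\<close> by (auto simp: field_simps)
  qed
  have ab: "0 \<le> a * n" "a * n \<le> b * n"
    using assms by (auto intro: mult_right_mono)
  have "card {k. k < n \<and> real k / n \<in> {a..b}} \<le> Suc (nat \<lfloor>b * n\<rfloor>) - nat \<lceil>a * n\<rceil>"
    using card_mono[OF _ 1] by simp
  moreover have "nat \<lfloor>b * n\<rfloor> - nat \<lceil>a * n\<rceil> \<le> card {k. k < n \<and> real k / n \<in> {a..b}}"
    using card_mono[OF _ 2] by simp
  ultimately show ?thesis
    using ab unfolding left_diff_distrib by linarith
qed

text \<open>For \<open>k < n\<close> the angle 2 pi k / n already lies in [0, 2 pi), so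
  \<open>theta\<close> recovers k/n exactly from the corresponding root of unity.\<close>

lemma roots_unity_theta:
  assumes "n > 0"
  shows "card {z. z ^ n = 1 \<and> theta z \<in> I} = card {k. k < n \<and> real k / n \<in> I}"
proof -
  have th: "theta (cis (2 * pi * real k / real n)) = real k / n" if "k < n" for k
  proof -
    have "Arg2pi (cis (2 * pi * real k / real n)) = 2 * pi * real k / real n"
      using that by (intro Arg2pi_unique[of 1]) (auto simp: cis_conv_exp field_simps)
    then show ?thesis by (simp add: theta_def)
  qed
  have bij: "bij_betw (\<lambda>k. cis (2 * pi * real k / real n)) {..<n} {z. z ^ n = 1}"
    using assms by (rule Complex.bij_betw_roots_unity)
  then have "inj_on (\<lambda>k. cis (2 * pi * real k / real n)) {k. k < n \<and> real k / n \<in> I}"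
    by (auto simp: bij_betw_def inj_on_def)
  moreover have "{z. z ^ n = 1} = (\<lambda>k. cis (2 * pi * real k / real n)) ` {..<n}"
    using bij by (simp add: bij_betw_def)
  then have "{z. z ^ n = 1 \<and> theta z \<in> I} =
      (\<lambda>k. cis (2 * pi * real k / real n)) ` {k. k < n \<and> real k / n \<in> I}"
    using th by (auto simp: set_eq_iff image_iff)
  ultimately show ?thesis
    by (simp add: card_image)
qed

text \<open>Compares the root set \<open>R\<close> with the set \<open>V\<close> of pq-th roots of
  unity in the same arc: R \<subseteq> V, and \<open>V\<close> exceeds \<open>R\<close> only by p-th
  or q-th roots of unity, at most p + q in number. Counting \<open>V\<close> itself adds the error
  2.\<close>

lemma card_alexander_roots_bound:
  fixes a b :: real
  assumes ab: "0 \<le> a" "a \<le> b" "b \<le> 1" and pq: "(p, q) \<in> torus_knots"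
  shows "\<bar>real (card {z. poly (alexander_poly (p, q)) z = 0 \<and> theta z \<in> {a..b}}) - (b - a) * (p * q)\<bar>
    \<le> p + q + 2"
proof -
  define R where "R = {z. poly (alexander_poly (p, q)) z = 0 \<and> theta z \<in> {a..b}}"
  define U where "U n = {z :: complex. z ^ n = 1}" for n
  define V where "V = {z. z ^ (p * q) = 1 \<and> theta z \<in> {a..b}}"
  have pos: "p > 0" "q > 0" using pq by (auto simp: torus_knots_def)
  have fin: "finite (U p)" "finite (U q)" "finite (U (p * q))"
    using pos by (auto simp: U_def intro: finite_roots_unity)
  have finV: "finite V"
    by (rule finite_subset[OF _ fin(3)]) (auto simp: V_def U_def)
  have cardU: "card (U p) \<le> p" "card (U q) \<le> q"
    using pos by (auto simp: U_def intro: card_roots_unity)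
  have id: "poly (alexander_poly (p, q)) z * ((z ^ p - 1) * (z ^ q - 1)) = (z ^ (p * q) - 1) * (z - 1)" for z
    using arg_cong[OF alexander_poly_mult_denominator[OF pq], of "\<lambda>f. poly f z"]
    by (simp add: poly_monom)
  \<comment> \<open>The factor \<open>z - 1\<close> contributes only z = 1, itself a pq-th root of
    unity.\<close>
  have RV: "R \<subseteq> V"
  proof
    fix z assume "z \<in> R"
    then show "z \<in> V"
      using id[of z] by (auto simp: R_def V_def)
  qed
  \<comment> \<open>Outside \<open>U p\<close> and \<open>U q\<close> the denominator is nonzero at
    z, so the product identity forces the Alexander polynomial to vanish there.\<close>
  have VR: "V \<subseteq> R \<union> (U p \<union> U q)"
  proof
    fix z assume "z \<in> V"
    then show "z \<in> R \<union> (U p \<union> U q)"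
      using id[of z] by (auto simp: R_def V_def U_def)
  qed
  have "card R \<le> card V"
    using card_mono[OF finV RV] .
  moreover have "card V \<le> card (R \<union> (U p \<union> U q))"
    using finite_subset[OF RV finV] fin VR by (intro card_mono) auto
  then have "card V \<le> card R + (p + q)"
    using card_Un_le[of R "U p \<union> U q"] card_Un_le[of "U p" "U q"] cardU by linarith
  moreover have "\<bar>real (card V) - (b - a) * (p * q)\<bar> \<le> 2"
    unfolding V_def using pos ab
    by (subst roots_unity_theta) (use card_fractions_bound[of a b "p * q"] in auto)
  ultimately show ?thesis
    unfolding R_def[symmetric] by linarith
qed

section \<open>Summation over all knots and the final estimate\<close>

lemma card_Omega1_restrict:
  assumes "X \<ge> 0"
  shows "card {(K, \<alpha>) \<in> Omega1 X. theta \<alpha> \<in> I} =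
    (\<Sum>K\<in>coprime_pairs (nat \<lfloor>X\<rfloor>). card {z. poly (alexander_poly K) z = 0 \<and> theta z \<in> I})"
proof -
  have eq: "coprime_pairs (nat \<lfloor>X\<rfloor>) = {K \<in> torus_knots. real (height K) \<le> X}"
    using assms
    by (auto simp: coprime_pairs_def torus_knots_def height_def Suc_le_eq le_nat_iff le_floor_iff)
  have "{(K, \<alpha>) \<in> Omega1 X. theta \<alpha> \<in> I} =
      (SIGMA K:coprime_pairs (nat \<lfloor>X\<rfloor>). {z. poly (alexander_poly K) z = 0 \<and> theta z \<in> I})"
    unfolding eq by (auto simp: Omega1_def)
  moreover have "finite {z. poly (alexander_poly K) z = 0 \<and> theta z \<in> I}"
    if "K \<in> coprime_pairs (nat \<lfloor>X\<rfloor>)" for K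
    by (rule finite_subset[OF _ poly_roots_finite[OF alexander_poly_nonzero]])
      (use that eq in auto)
  ultimately show ?thesis
    by (simp add: card_SigmaI)
qed

text \<open>Four errors are added: \<open>e1\<close> from counting roots knot by knot,
  \<open>e2\<close> from Moebius inversion, \<open>e3\<close> from completing the mu-sum to 1 /
  \<open>zeta2\<close>, and \<open>e4\<close> from replacing \<open>N\<close> by \<open>X\<close>.
  The condition X \<ge> 3 ensures ln X \<ge> 1, so that X^3 is absorbed by X^3 ln X.\<close>

lemma card_Omega1_bound:
  fixes a b X :: real
  assumes ab: "0 \<le> a" "a \<le> b" "b \<le> 1" and X: "X \<ge> 3"
  shows "\<bar>real (card {(K, \<alpha>) \<in> Omega1 X. theta \<alpha> \<in> {a..b}}) - (b - a) / (4 * zeta2) * X ^ 4\<bar>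
    \<le> 10 * (X ^ 3 * ln X)"
proof -
  define N where "N = nat \<lfloor>X\<rfloor>"
  define c where "c K = card {z. poly (alexander_poly K) z = 0 \<and> theta z \<in> {a..b}}" for K
  define C where "C = (\<Sum>K\<in>coprime_pairs N. real (c K))"
  define S where "S = (\<Sum>(p, q)\<in>coprime_pairs N. real (p * q))"
  define M where "M = (\<Sum>d=1..N. moebius d / real d ^ 2)"
  define L where "L = ln X"
  have N: "real N \<le> X" "X - 1 \<le> real N" "N > 0"
    using X unfolding N_def by linarith+
  have L1: "L \<ge> 1"
  proof -
    have "exp 1 \<le> (3 :: real)" using exp_le by simp
    then show ?thesis using X unfolding L_def by (subst ln_ge_iff) auto
  qed
  have "ln (real N) \<le> L" using N by (simp add: L_def)
  \<comment> \<open>The sequence harm n - ln n decreases from its value 1 at n = 1, so harm N \<le>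
    ln N + 1 \<le> 2 L.\<close>
  then have H: "harm N \<le> 2 * L" 
    using euler_mascheroni_sequence_decreasing[of 1 N] N(3) L1 by (simp add: harm_expand)
  have H0: "(harm N :: real) \<ge> 0" by (simp add: harm_nonneg)
  have N3: "real N ^ 3 \<le> X ^ 3" using N by (intro power_mono) auto
  have X3: "0 \<le> X ^ 3" "X ^ 3 \<le> X ^ 3 * L" using X L1 by simp_all

  have "\<bar>C - (b - a) * S\<bar> = \<bar>\<Sum>K\<in>coprime_pairs N. real (c K) - (b - a) * (fst K * snd K)\<bar>"
    by (simp add: C_def S_def sum_subtractf sum_distrib_left case_prod_unfold)
  \<comment> \<open>The error per knot is p + q + 2, at most 4 N because 1 \<le> N.\<close>
  also have "\<dots> \<le> (\<Sum>K\<in>coprime_pairs N. 4 * real N)"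
  proof (rule order.trans[OF sum_abs], intro sum_mono)
    fix K assume K: "K \<in> coprime_pairs N"
    obtain p q where pq: "K = (p, q)" by (cases K)
    have "(p, q) \<in> torus_knots" "p \<le> N" "q \<le> N"
      using K pq by (auto simp: coprime_pairs_def torus_knots_def)
    with card_alexander_roots_bound[OF ab, of p q] N(3)
    show "\<bar>real (c K) - (b - a) * (fst K * snd K)\<bar> \<le> 4 * real N"
      unfolding pq c_def by simp
  qed
  also have "\<dots> = real (card (coprime_pairs N)) * (4 * real N)" by simp
  also have "\<dots> \<le> real (N ^ 2) * (4 * real N)"
    using card_coprime_pairs_le by (intro mult_right_mono) (auto simp del: of_nat_power)
  also have "\<dots> = 4 * real N ^ 3" by (simp add: power2_eq_square power3_eq_cube)
  finally have e1: "\<bar>C - (b - a) * S\<bar> \<le> 4 * X ^ 3" using N3 by linarith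

  have NH: "real N ^ 3 * harm N \<le> X ^ 3 * (2 * L)"
    using N3 H H0 X by (intro mult_mono) auto
  have e2: "\<bar>S - real N ^ 4 / 4 * M\<bar> \<le> 3/2 * (X ^ 3 * L)"
    using sum_coprime_pairs_bound[of N] NH unfolding S_def M_def by linarith
  have "\<bar>real N ^ 4 / 4 * M - real N ^ 4 / 4 * (1 / zeta2)\<bar> = real N ^ 4 / 4 * \<bar>M - 1 / zeta2\<bar>"
    unfolding right_diff_distrib[symmetric] abs_mult by simp
  also have "\<dots> \<le> real N ^ 4 / 4 * (2 * harm N / N)"
    using sum_moebius_bound[OF N(3)] unfolding M_def by (intro mult_left_mono) auto
  also have "\<dots> = real N ^ 3 * harm N / 2"
    using N(3) by (simp add: power3_eq_cube power4_eq_xxxx)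
  finally have e3: "\<bar>real N ^ 4 / 4 * M - real N ^ 4 / 4 * (1 / zeta2)\<bar> \<le> X ^ 3 * L"
    using NH by linarith
  \<comment> \<open>Rounding X down costs only O(X^3), since X - N \<le> 1.\<close>
  have "X ^ 4 - real N ^ 4 = (X - N) * (X ^ 3 + X ^ 2 * N + X * real N ^ 2 + real N ^ 3)"
    by (simp add: algebra_simps power2_eq_square power3_eq_cube power4_eq_xxxx)
  also have "\<dots> \<le> 1 * (X ^ 3 + X ^ 2 * X + X * X ^ 2 + X ^ 3)"
    using N X by (intro mult_mono add_mono power_mono order.refl) (auto intro!: add_nonneg_nonneg)
  finally have "X ^ 4 - real N ^ 4 \<le> 4 * X ^ 3"
    by (simp add: power2_eq_square power3_eq_cube)
  moreover have "real N ^ 4 \<le> X ^ 4" using N by (intro power_mono) auto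
  ultimately have "\<bar>real N ^ 4 - X ^ 4\<bar> \<le> 4 * X ^ 3" by linarith
  then have "\<bar>real N ^ 4 - X ^ 4\<bar> / (4 * zeta2) \<le> 4 * X ^ 3 / (4 * 1)"
    using zeta2_ge_1 X by (intro frac_le) auto
  moreover have "real N ^ 4 / 4 * (1 / zeta2) - X ^ 4 / (4 * zeta2) = (real N ^ 4 - X ^ 4) / (4 * zeta2)"
    by (simp add: diff_divide_distrib)
  ultimately have e4: "\<bar>real N ^ 4 / 4 * (1 / zeta2) - X ^ 4 / (4 * zeta2)\<bar> \<le> X ^ 3"
    using zeta2_ge_1 by simp
  have "\<bar>S - X ^ 4 / (4 * zeta2)\<bar> \<le> 5/2 * (X ^ 3 * L) + X ^ 3"
    using e2 e3 e4 by linarith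
  then have "(b - a) * \<bar>S - X ^ 4 / (4 * zeta2)\<bar> \<le> 1 * (5/2 * (X ^ 3 * L) + X ^ 3)"
    using ab by (intro mult_mono) auto
  then have "\<bar>(b - a) * S - (b - a) / (4 * zeta2) * X ^ 4\<bar> \<le> 5/2 * (X ^ 3 * L) + X ^ 3"
    using ab abs_mult[of "b - a" "S - X ^ 4 / (4 * zeta2)"] by (simp add: right_diff_distrib)
  \<comment> \<open>The contributions 4 + 5/2 + 1 = 15/2 stay below the round constant 10.\<close>
  then have "\<bar>C - (b - a) / (4 * zeta2) * X ^ 4\<bar> \<le> 10 * (X ^ 3 * L)"
    using e1 X3 by linarith
  moreover have "real (card {(K, \<alpha>) \<in> Omega1 X. theta \<alpha> \<in> {a..b}}) = C"
    using X by (subst card_Omega1_restrict) (auto simp: C_def c_def N_def)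
  ultimately show ?thesis by (simp add: L_def)
qed

theorem theorem1:
  fixes a b :: real
  assumes "0 \<le> a" and "a \<le> b" and "b \<le> 1"
  shows "(\<lambda>X::real. real (card {(K, \<alpha>) \<in> Omega1 X. theta \<alpha> \<in> {a..b}})
            - (b - a) / (4 * zeta2) * X ^ 4)
         \<in> O[at_top](\<lambda>X. X ^ 3 * ln X)"
proof (rule bigoI)
  show "\<forall>\<^sub>F X in at_top.
      norm (real (card {(K, \<alpha>) \<in> Omega1 X. theta \<alpha> \<in> {a..b}}) - (b - a) / (4 * zeta2) * X ^ 4)
      \<le> 10 * norm (X ^ 3 * ln X)"
    using eventually_ge_at_top[of 3]
  proof eventually_elim
    case (elim X)
    then have "X ^ 3 * ln X \<ge> 0" by simp
    then show ?case
      using card_Omega1_bound[OF assms elim] by simp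
  qed
qed

end
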